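(* Let $X$ be a set, $Y$ a topological space, $f:X\to Y$ a mapping, and $d$ a metric on the mapping $f$. Then $d$ is complete if and only if for every $y\in Y$, every Cauchy net (on the mapping $f$) tied to $y$ converges to some point of the fibre $f^{-1}(\{y\})$ with respect to the metric topology $\tau(f,d)$ of $f$.
   Context: Let $X$ be a set, $Y$ a topological space with topology $\tau(Y)$, and $f:X\to Y$ a mapping. Metric on a mapping: a pseudometric $d$ on $X$ is called a metric on the mapping $f$ if for every $y\in Y$ the restriction of $d$ to $f^{-1}(\{y\})\times f^{-1}(\{y\})$ is a metric on $f^{-1}(\{y\})$. Metric topology of $f$: $\tau(f,d)$ is the topology on $X$ having $\tau(d)\cup f^{-1}(\tau(Y))$ as a subbase, where $\tau(d)$ is the topology generated by the pseudometric $d$ and $f^{-1}(\tau(Y))=\{f^{-1}(V): V\in\tau(Y)\}$; a base for it is $\{U\cap f^{-1}(V): U\in\tau(d),\ V\in\tau(Y)\}$. Complete metric: for $y\in Y$ let $\mathcal N_y$ be the family of neighborhoods of $y$ in $Y$ and $f^{-1}(\mathcal N_y)=\{f^{-1}(O): O\in\mathcal N_y\}$. A metric $d$ on $f$ is complete if for every $y\in Y$ and every (proper) filter $\mathcal F$ on $X$ such that $f^{-1}(\mathcal N_y)\subseteq\mathcal F$ and for every $\epsilon>0$ there is $F\in\mathcal F$ with $\mathrm{diam}(F)<\epsilon$ (diameter with respect to $d$), one has $f^{-1}(\{y\})\cap a_X(\mathcal F)\neq\emptyset$, where $a_X(\mathcal F)$ is the set of cluster (adherent) points of $\mathcal F$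 with respect to $\tau(f,d)$. Cauchy net tied to $y$: a net $\Phi:D\to X$ ($D$ a nonempty directed set) is a Cauchy net (on the mapping $f$) tied to $y\in Y$ if (i) for every $\epsilon>0$ there is $\alpha\in D$ such that $d(\Phi(\beta),\Phi(\gamma))<\epsilon$ for all $\beta,\gamma\ge\alpha$; and (ii) for every neighborhood $O$ of $y$ in $Y$ there is $\alpha\in D$ such that $\Phi(\beta)\in f^{-1}(O)$ for all $\beta\ge\alpha$. *)

theory Defs
  imports "HOL-Analysis.Analysis"
begin

definition fibre :: "'a set \<Rightarrow> ('a \<Rightarrow> 'b) \<Rightarrow> 'b \<Rightarrow> 'a set" where
  "fibre X f y = {x \<in> X. f x = y}"

text \<open>As in the library locale \<^locale>\<open>Metric_space\<close>, the distance function is total and is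
  nonnegative and symmetric everywhere; its values outside the carrier are otherwise irrelevant.\<close>

locale Pseudometric_space =
  fixes X :: "'a set" and d :: "'a \<Rightarrow> 'a \<Rightarrow> real"
  assumes nonneg: "\<And>x y. 0 \<le> d x y"
    and commute: "\<And>x y. d x y = d y x"
    and refl_zero: "\<And>x. x \<in> X \<Longrightarrow> d x x = 0"
    and triangle: "\<And>x y z. \<lbrakk>x \<in> X; y \<in> X; z \<in> X\<rbrakk> \<Longrightarrow> d x z \<le> d x y + d y z"

definition metric_on_mapping ::
  "'a set \<Rightarrow> 'b topology \<Rightarrow> ('a \<Rightarrow> 'b) \<Rightarrow> ('a \<Rightarrow> 'a \<Rightarrow> real) \<Rightarrow> bool" where
  "metric_on_mapping X Y f d \<longleftrightarrow>
     Pseudometric_space X d \<and> (\<forall>y \<in> topspace Y. Metric_space (fibre X f y) d)"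

definition pmtopology :: "'a set \<Rightarrow> ('a \<Rightarrow> 'a \<Rightarrow> real) \<Rightarrow> 'a topology" where
  "pmtopology X d =
     topology (\<lambda>U. U \<subseteq> X \<and> (\<forall>x\<in>U. \<exists>r>0. {z \<in> X. d x z < r} \<subseteq> U))"

lemma openin_pmtopology:
  "openin (pmtopology X d) U \<longleftrightarrow> U \<subseteq> X \<and> (\<forall>x\<in>U. \<exists>r>0. {z \<in> X. d x z < r} \<subseteq> U)"
proof -
  have "istopology (\<lambda>U. U \<subseteq> X \<and> (\<forall>x\<in>U. \<exists>r>0. {z \<in> X. d x z < r} \<subseteq> U))"
    unfolding istopology_def
  proof (intro conjI allI impI)
    fix S T
    assume S: "S \<subseteq> X \<and> (\<forall>x\<in>S. \<exists>r>0. {z \<in> X. d x z < r} \<subseteq> S)"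
      and T: "T \<subseteq> X \<and> (\<forall>x\<in>T. \<exists>r>0. {z \<in> X. d x z < r} \<subseteq> T)"
    show "S \<inter> T \<subseteq> X" using S by blast
    show "\<forall>x\<in>S \<inter> T. \<exists>r>0. {z \<in> X. d x z < r} \<subseteq> S \<inter> T"
    proof
      fix x assume "x \<in> S \<inter> T"
      then obtain r s where "r > 0" "{z \<in> X. d x z < r} \<subseteq> S" "s > 0" "{z \<in> X. d x z < s} \<subseteq> T"
        using S T by blast
      then show "\<exists>r>0. {z \<in> X. d x z < r} \<subseteq> S \<inter> T"
        by (intro exI[of _ "min r s"]) auto
    qed
  next
    fix K
    assume K: "\<forall>S\<in>K. S \<subseteq> X \<and> (\<forall>x\<in>S. \<exists>r>0. {z \<in> X. d x z < r} \<subseteq> S)"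
    then show "\<Union>K \<subseteq> X" by blast
    show "\<forall>x\<in>\<Union>K. \<exists>r>0. {z \<in> X. d x z < r} \<subseteq> \<Union>K"
      using K by (meson Union_iff Union_upper subset_trans)
  qed
  then show ?thesis
    by (simp add: pmtopology_def topology_inverse')
qed

lemma topspace_pmtopology [simp]: "topspace (pmtopology X d) = X"
proof -
  have "openin (pmtopology X d) X"
    by (auto simp: openin_pmtopology intro: exI[of _ "1::real"])
  then show ?thesis
    by (metis openin_pmtopology openin_subset openin_topspace subset_antisym)
qed

definition mapping_topology ::
  "'a set \<Rightarrow> 'b topology \<Rightarrow> ('a \<Rightarrow> 'b) \<Rightarrow> ('a \<Rightarrow> 'a \<Rightarrow> real) \<Rightarrow> 'a topology" where
  "mapping_topology X Y f d =
     topology_generated_by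
       ({U. openin (pmtopology X d) U} \<union> {{x \<in> X. f x \<in> V} | V. openin Y V})"

lemma topspace_mapping_topology [simp]: "topspace (mapping_topology X Y f d) = X"
proof -
  have "openin (pmtopology X d) X"
    by (metis openin_topspace topspace_pmtopology)
  then show ?thesis
    by (auto simp: mapping_topology_def openin_pmtopology)
qed

definition nbhds :: "'b topology \<Rightarrow> 'b \<Rightarrow> 'b set set" where
  "nbhds Y y = {N. N \<subseteq> topspace Y \<and> (\<exists>U. openin Y U \<and> y \<in> U \<and> U \<subseteq> N)}"

text \<open>Valued in \<^typ>\<open>ennreal\<close>, so that the diameter of an unbounded set is infinite.\<close>

definition pdiam :: "('a \<Rightarrow> 'a \<Rightarrow> real) \<Rightarrow> 'a set \<Rightarrow> ennreal" where
  "pdiam d S = (SUP x\<in>S. SUP z\<in>S. ennreal (d x z))"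

text \<open>A set \<open>S\<close> is a member of a filter \<open>F\<close> iff \<open>eventually (\<lambda>x. x \<in> S) F\<close>.\<close>

definition cluster_points :: "'a topology \<Rightarrow> 'a filter \<Rightarrow> 'a set" where
  "cluster_points T F =
     {x \<in> topspace T. \<forall>S. eventually (\<lambda>z. z \<in> S) F \<longrightarrow> x \<in> T closure_of S}"

text \<open>The proper filters on the set \<open>X\<close> are represented by the filters \<open>F \<noteq> bot\<close> on the ambient
  type with \<open>F \<le> principal X\<close>, i.e. those having \<open>X\<close> as a member.\<close>

definition complete_metric_on_mapping ::
  "'a set \<Rightarrow> 'b topology \<Rightarrow> ('a \<Rightarrow> 'b) \<Rightarrow> ('a \<Rightarrow> 'a \<Rightarrow> real) \<Rightarrow> bool" where
  "complete_metric_on_mapping X Y f d \<longleftrightarrow>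
     (\<forall>y \<in> topspace Y. \<forall>F.
        F \<noteq> bot \<and> F \<le> principal X \<and>
        (\<forall>N \<in> nbhds Y y. eventually (\<lambda>x. x \<in> {x \<in> X. f x \<in> N}) F) \<and>
        (\<forall>\<epsilon>::real. \<epsilon> > 0 \<longrightarrow>
           (\<exists>S \<subseteq> X. eventually (\<lambda>x. x \<in> S) F \<and> pdiam d S < ennreal \<epsilon>)) \<longrightarrow>
        fibre X f y \<inter> cluster_points (mapping_topology X Y f d) F \<noteq> {})"

definition directed_set :: "'i set \<Rightarrow> ('i \<Rightarrow> 'i \<Rightarrow> bool) \<Rightarrow> bool" where
  "directed_set D le \<longleftrightarrow>
     D \<noteq> {} \<and> reflp_on D le \<and> transp_on D le \<and>
     (\<forall>a\<in>D. \<forall>b\<in>D. \<exists>c\<in>D. le a c \<and> le b c)"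

definition net_converges ::
  "'a topology \<Rightarrow> 'i set \<Rightarrow> ('i \<Rightarrow> 'i \<Rightarrow> bool) \<Rightarrow> ('i \<Rightarrow> 'a) \<Rightarrow> 'a \<Rightarrow> bool" where
  "net_converges T D le \<Phi> x \<longleftrightarrow>
     x \<in> topspace T \<and>
     (\<forall>U. openin T U \<and> x \<in> U \<longrightarrow> (\<exists>a\<in>D. \<forall>b\<in>D. le a b \<longrightarrow> \<Phi> b \<in> U))"

definition cauchy_net_tied_to ::
  "'a set \<Rightarrow> 'b topology \<Rightarrow> ('a \<Rightarrow> 'b) \<Rightarrow> ('a \<Rightarrow> 'a \<Rightarrow> real) \<Rightarrow>
     'i set \<Rightarrow> ('i \<Rightarrow> 'i \<Rightarrow> bool) \<Rightarrow> ('i \<Rightarrow> 'a) \<Rightarrow> 'b \<Rightarrow> bool" where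
  "cauchy_net_tied_to X Y f d D le \<Phi> y \<longleftrightarrow>
     directed_set D le \<and> \<Phi> \<in> D \<rightarrow> X \<and>
     (\<forall>\<epsilon>>0. \<exists>a\<in>D. \<forall>b\<in>D. \<forall>c\<in>D. le a b \<and> le a c \<longrightarrow> d (\<Phi> b) (\<Phi> c) < \<epsilon>) \<and>
     (\<forall>N \<in> nbhds Y y. \<exists>a\<in>D. \<forall>b\<in>D. le a b \<longrightarrow> \<Phi> b \<in> {x \<in> X. f x \<in> N})"

end

theory Submission
  imports Defs
begin

text \<open>A net generates the filter of its tails, which is Cauchy whenever the net is; since the net is
  Cauchy, any cluster point of that filter in the fibre is already a limit of the net. Conversely, a
  filter \<open>F\<close> is turned into the net of its pointed members \<open>(x, S)\<close>, \<open>x \<in> S \<in> F\<close>, ordered by reverse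
  inclusion of \<open>S\<close>, and every limit of this net is a cluster point of \<open>F\<close>.\<close>

section \<open>Basic neighbourhoods in the metric topology of a mapping\<close>

lemma (in Pseudometric_space) openin_pmtopology_ball:
  assumes "x \<in> X"
  shows "openin (pmtopology X d) {z \<in> X. d x z < r}"
  unfolding openin_pmtopology
proof (intro conjI ballI)
  fix z assume z: "z \<in> {z \<in> X. d x z < r}"
  have "{w \<in> X. d z w < r - d x z} \<subseteq> {z \<in> X. d x z < r}"
  proof
    fix w assume "w \<in> {w \<in> X. d z w < r - d x z}"
    then show "w \<in> {z \<in> X. d x z < r}"
      using triangle[of x z w] z assms by auto
  qed
  then show "\<exists>s>0. {w \<in> X. d z w < s} \<subseteq> {z \<in> X. d x z < r}"
    using z by (intro exI[of _ "r - d x z"]) auto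
qed auto

lemma openin_mapping_topology_pmtopology:
  assumes "openin (pmtopology X d) U"
  shows "openin (mapping_topology X Y f d) U"
  unfolding mapping_topology_def openin_topology_generated_by_iff
  using assms by (auto intro: generate_topology_on.Basis)

text \<open>By induction over the generation of the topology. A subbasic set imposes only one of the
  two constraints; the other is filled in by \<open>topspace Y\<close>, harmless because
  \<open>f\<close> maps \<open>X\<close> into it, or by the arbitrary radius 1.\<close>

lemma openin_mapping_topologyD:
  assumes "openin (mapping_topology X Y f d) U" and "x \<in> U"
    and "f \<in> X \<rightarrow> topspace Y"
  shows "\<exists>r>0. \<exists>V. openin Y V \<and> f x \<in> V \<and> {z \<in> X. d x z < r \<and> f z \<in> V} \<subseteq> U"
proof -
  have "generate_topology_on
          ({U. openin (pmtopology X d) U} \<union> {{x \<in> X. f x \<in> V} | V. openin Y V}) U"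
    using assms(1) unfolding mapping_topology_def openin_topology_generated_by_iff .
  then show ?thesis
    using \<open>x \<in> U\<close>
  proof (induction rule: generate_topology_on.induct)
    case Empty
    then show ?case by simp
  next
    case (Int A B)
    then obtain r V s W where
      "r > 0" "openin Y V" "f x \<in> V" "{z \<in> X. d x z < r \<and> f z \<in> V} \<subseteq> A"
      "s > 0" "openin Y W" "f x \<in> W" "{z \<in> X. d x z < s \<and> f z \<in> W} \<subseteq> B"
      by blast
    then show ?case
      by (intro exI[of _ "min r s"] conjI exI[of _ "V \<inter> W"]) auto
  next
    case (UN K)
    then obtain k where "k \<in> K" "x \<in> k" by blast
    with UN.IH[OF this] show ?case by blast
  next
    case (Basis S)
    then consider "openin (pmtopology X d) S" | V where "openin Y V" "S = {x \<in> X. f x \<in> V}"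
      by auto
    then show ?case
    proof cases
      case 1
      then obtain r where "r > 0" "{z \<in> X. d x z < r} \<subseteq> S" "x \<in> X"
        using Basis.prems unfolding openin_pmtopology by blast
      then show ?thesis
        using assms(3) by (intro exI[of _ r] conjI exI[of _ "topspace Y"]) auto
    next
      case 2
      then show ?thesis
        using Basis.prems by (intro exI[of _ 1] conjI exI[of _ V]) auto
    qed
  qed
qed

section \<open>Tail filters, and convergence of Cauchy nets under completeness\<close>

lemma directed_setD_ub:
  assumes "directed_set D le" and "a \<in> D" and "b \<in> D"
  shows "\<exists>c\<in>D. le a c \<and> le b c"
  using assms by (simp add: directed_set_def)

lemma directed_setD_trans:
  assumes "directed_set D le" and "a \<in> D" and "b \<in> D" and "c \<in> D" and "le a b" and "le b c"
  shows "le a c"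
  using assms transp_onD[of D le a b c] by (simp add: directed_set_def)

definition net_filter :: "'i set \<Rightarrow> ('i \<Rightarrow> 'i \<Rightarrow> bool) \<Rightarrow> ('i \<Rightarrow> 'a) \<Rightarrow> 'a filter" where
  "net_filter D le \<Phi> = (INF a\<in>D. principal {\<Phi> b | b. b \<in> D \<and> le a b})"

text \<open>Directedness makes the tails a filter base: any two tails contain a common later tail,
  so a single tail witnesses membership in the infimum.\<close>

lemma eventually_net_filter:
  assumes "directed_set D le"
  shows "eventually P (net_filter D le \<Phi>) \<longleftrightarrow> (\<exists>a\<in>D. \<forall>b\<in>D. le a b \<longrightarrow> P (\<Phi> b))"
proof -
  let ?T = "\<lambda>a. {\<Phi> b | b. b \<in> D \<and> le a b}"
  have "\<exists>c\<in>D. principal (?T c) \<le> inf (principal (?T a)) (principal (?T b))"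
    if ab: "a \<in> D" "b \<in> D" for a b
  proof -
    obtain c where c: "c \<in> D" "le a c" "le b c"
      using directed_setD_ub[OF assms ab] by blast
    have "le a e \<and> le b e" if "e \<in> D" "le c e" for e
      using directed_setD_trans[OF assms _ c(1)] that c ab by blast
    then have "?T c \<subseteq> ?T a \<inter> ?T b" by blast
    then show ?thesis using c(1) by auto
  qed
  moreover have "D \<noteq> {}" using assms by (simp add: directed_set_def)
  ultimately have "eventually P (net_filter D le \<Phi>) \<longleftrightarrow>
      (\<exists>a\<in>D. eventually P (principal (?T a)))"
    unfolding net_filter_def by (intro eventually_INF_base) auto
  then show ?thesis by (auto simp: eventually_principal)
qed

lemma net_filter_neq_bot:
  assumes "directed_set D le"
  shows "net_filter D le \<Phi> \<noteq> bot"
proof -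
  \<comment> \<open>Reflexivity puts \<open>a\<close> beyond itself, so no tail is empty.\<close>
  have "\<exists>b\<in>D. le a b" if "a \<in> D" for a
    using assms that unfolding directed_set_def by blast
  then show ?thesis
    unfolding trivial_limit_def eventually_net_filter[OF assms] by blast
qed

text \<open>The two constraints of a basic neighbourhood have different sources. Being tied to
  \<open>y = f x\<close> keeps the net in the preimage of \<open>V\<close>; clustering brings one
  value close to \<open>x\<close>, and the Cauchy condition carries this over to all late
  values.\<close>

lemma cauchy_net_cluster_point_imp_converges:
  fixes \<Phi> :: "'i \<Rightarrow> 'a"
  assumes "Pseudometric_space X d" and "f \<in> X \<rightarrow> topspace Y"
    and cauchy: "cauchy_net_tied_to X Y f d D le \<Phi> y"
    and x: "x \<in> fibre X f y"
      "x \<in> cluster_points (mapping_topology X Y f d) (net_filter D le \<Phi>)"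
  shows "net_converges (mapping_topology X Y f d) D le \<Phi> x"
  unfolding net_converges_def
proof (intro conjI allI impI)
  interpret Pseudometric_space X d by fact
  have dir: "directed_set D le" and \<Phi>: "\<Phi> \<in> D \<rightarrow> X"
    using cauchy by (auto simp: cauchy_net_tied_to_def)
  have xX: "x \<in> X" and fx: "f x = y" using x(1) by (auto simp: fibre_def)
  then show "x \<in> topspace (mapping_topology X Y f d)" by simp
  fix U assume "openin (mapping_topology X Y f d) U \<and> x \<in> U"
  then obtain r V where r: "r > 0" and V: "openin Y V" "f x \<in> V"
    and U: "{z \<in> X. d x z < r \<and> f z \<in> V} \<subseteq> U"
    using openin_mapping_topologyD[of X Y f d U x] assms(2) by blast
  have "V \<in> nbhds Y y"
    unfolding nbhds_def using V fx openin_subset[OF V(1)] by blast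
  then have "\<exists>a\<in>D. \<forall>b\<in>D. le a b \<longrightarrow> \<Phi> b \<in> {x \<in> X. f x \<in> V}"
    using cauchy by (simp add: cauchy_net_tied_to_def)
  then obtain a1 where a1: "a1 \<in> D" "\<And>b. b \<in> D \<Longrightarrow> le a1 b \<Longrightarrow> f (\<Phi> b) \<in> V"
    by blast
  have "r / 2 > 0" using r by simp
  then obtain a2 where a2: "a2 \<in> D"
    "\<And>b c. b \<in> D \<Longrightarrow> c \<in> D \<Longrightarrow> le a2 b \<Longrightarrow> le a2 c \<Longrightarrow> d (\<Phi> b) (\<Phi> c) < r / 2"
    using cauchy unfolding cauchy_net_tied_to_def by blast
  obtain a where a: "a \<in> D" "le a1 a" "le a2 a"
    using directed_setD_ub[OF dir a1(1) a2(1)] by blast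
  have "eventually (\<lambda>z. z \<in> {\<Phi> b | b. b \<in> D \<and> le a2 b}) (net_filter D le \<Phi>)"
    unfolding eventually_net_filter[OF dir] using a2(1) by blast
  then have "x \<in> mapping_topology X Y f d closure_of {\<Phi> b | b. b \<in> D \<and> le a2 b}"
    using x(2) unfolding cluster_points_def by blast
  then have closure: "\<exists>z. z \<in> {\<Phi> b | b. b \<in> D \<and> le a2 b} \<and> z \<in> W"
    if "x \<in> W" "openin (mapping_topology X Y f d) W" for W
    using that unfolding in_closure_of by blast
  have "openin (mapping_topology X Y f d) {z \<in> X. d x z < r / 2}"
    by (intro openin_mapping_topology_pmtopology openin_pmtopology_ball xX)
  moreover have "x \<in> {z \<in> X. d x z < r / 2}" using xX r refl_zero by simp
  \<comment> \<open>\<open>b\<close> lies beyond \<open>a2\<close> but perhaps not beyond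
    \<open>a\<close>; the Cauchy bound past \<open>a2\<close> still links it to every
    \<open>c\<close> beyond \<open>a\<close>.\<close>
  ultimately obtain b where b: "b \<in> D" "le a2 b" "d x (\<Phi> b) < r / 2"
    using closure[of "{z \<in> X. d x z < r / 2}"] by blast
  show "\<exists>a\<in>D. \<forall>b\<in>D. le a b \<longrightarrow> \<Phi> b \<in> U"
  proof (intro bexI[OF _ a(1)] ballI impI)
    fix c assume c: "c \<in> D" "le a c"
    have "le a1 c" "le a2 c"
      using directed_setD_trans[OF dir _ a(1) c(1)] a c(2) a1(1) a2(1) by auto
    moreover have "d x (\<Phi> c) \<le> d x (\<Phi> b) + d (\<Phi> b) (\<Phi> c)"
      using triangle xX \<Phi> b(1) c(1) by (simp add: Pi_iff)
    moreover have "\<Phi> c \<in> X" using \<Phi> c(1) by (simp add: Pi_iff)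
    ultimately have "\<Phi> c \<in> {z \<in> X. d x z < r \<and> f z \<in> V}"
      using a1(2)[OF c(1)] a2(2)[OF b(1) c(1) b(2)] b(3) by simp
    then show "\<Phi> c \<in> U" using U by blast
  qed
qed

lemma complete_imp_cauchy_net_converges:
  fixes \<Phi> :: "'i \<Rightarrow> 'a"
  assumes "Pseudometric_space X d" and "f \<in> X \<rightarrow> topspace Y"
    and complete: "complete_metric_on_mapping X Y f d" and y: "y \<in> topspace Y"
    and cauchy: "cauchy_net_tied_to X Y f d D le \<Phi> y"
  shows "\<exists>x\<in>fibre X f y. net_converges (mapping_topology X Y f d) D le \<Phi> x"
proof -
  let ?F = "net_filter D le \<Phi>"
  have dir: "directed_set D le" and \<Phi>: "\<Phi> \<in> D \<rightarrow> X"
    using cauchy by (auto simp: cauchy_net_tied_to_def)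
  note ev = eventually_net_filter[OF dir]
  have "?F \<le> principal X"
    unfolding le_principal ev using \<Phi> dir by (auto simp: directed_set_def)
  moreover have "\<forall>N\<in>nbhds Y y. eventually (\<lambda>x. x \<in> {x \<in> X. f x \<in> N}) ?F"
    using cauchy unfolding ev cauchy_net_tied_to_def by blast
  moreover have "\<exists>S\<subseteq>X. eventually (\<lambda>x. x \<in> S) ?F \<and> pdiam d S < ennreal \<epsilon>"
    if "\<epsilon> > 0" for \<epsilon> :: real
  proof -
    \<comment> \<open>Strict bounds on distances give only a weak bound on their supremum; halving
      restores strictness.\<close>
    have "\<epsilon> / 2 > 0" using that by simp
    then obtain a where a: "a \<in> D"
      "\<And>b c. b \<in> D \<Longrightarrow> c \<in> D \<Longrightarrow> le a b \<Longrightarrow> le a c \<Longrightarrow> d (\<Phi> b) (\<Phi> c) < \<epsilon> / 2"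
      using cauchy unfolding cauchy_net_tied_to_def by blast
    let ?S = "{\<Phi> b | b. b \<in> D \<and> le a b}"
    have "pdiam d ?S \<le> ennreal (\<epsilon> / 2)"
      unfolding pdiam_def using a(2) by (intro SUP_least ennreal_leI) (auto intro: less_imp_le)
    also have "\<dots> < ennreal \<epsilon>"
      using that by (simp add: ennreal_less_iff)
    finally have "pdiam d ?S < ennreal \<epsilon>" .
    moreover have "?S \<subseteq> X" using \<Phi> by auto
    moreover have "eventually (\<lambda>x. x \<in> ?S) ?F" unfolding ev using a(1) by blast
    ultimately show ?thesis by blast
  qed
  ultimately have "fibre X f y \<inter> cluster_points (mapping_topology X Y f d) ?F \<noteq> {}"
    using complete y net_filter_neq_bot[OF dir] unfolding complete_metric_on_mapping_def by blast
  then show ?thesis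
    using cauchy_net_cluster_point_imp_converges[OF assms(1,2) cauchy] by blast
qed

section \<open>From filters to nets, and the converse implication\<close>

definition pointed_members :: "'a set \<Rightarrow> 'a filter \<Rightarrow> ('a \<times> 'a set) set" where
  "pointed_members X F = {(x, S). x \<in> S \<and> S \<subseteq> X \<and> eventually (\<lambda>z. z \<in> S) F}"

text \<open>The order ignores the points, so it is a preorder and in general not
  antisymmetric.\<close>

abbreviation pointed_le :: "'a \<times> 'a set \<Rightarrow> 'a \<times> 'a set \<Rightarrow> bool" where
  "pointed_le p q \<equiv> snd q \<subseteq> snd p"

lemma pointed_membersI:
  assumes "F \<noteq> bot" and "S \<subseteq> X" and "eventually (\<lambda>z. z \<in> S) F"
  obtains x where "(x, S) \<in> pointed_members X F"
  using assms eventually_happens[of "\<lambda>z. z \<in> S" F] by (auto simp: pointed_members_def)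

text \<open>An upper bound is the intersection of the two members; it is inhabited because
  \<open>F\<close> is proper, and any of its points will do.\<close>

lemma directed_set_pointed_members:
  assumes "F \<noteq> bot" and "F \<le> principal X"
  shows "directed_set (pointed_members X F) pointed_le"
  unfolding directed_set_def
proof (intro conjI ballI)
  show "pointed_members X F \<noteq> {}"
    using pointed_membersI[of F X X] assms by (auto simp: le_principal)
  fix p q assume "p \<in> pointed_members X F" "q \<in> pointed_members X F"
  then have "snd p \<inter> snd q \<subseteq> X" "eventually (\<lambda>z. z \<in> snd p \<inter> snd q) F"
    by (auto simp: pointed_members_def eventually_conj_iff)
  then obtain x where "(x, snd p \<inter> snd q) \<in> pointed_members X F"
    using pointed_membersI[OF assms(1)] by blast
  then show "\<exists>c\<in>pointed_members X F. pointed_le p c \<and> pointed_le q c"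
    by (intro bexI[of _ "(x, snd p \<inter> snd q)"]) auto
qed (auto simp: reflp_on_def transp_on_def)

text \<open>Beyond an index \<open>(x, S)\<close> every point lies in \<open>S\<close>, since later
  members are subsets of \<open>S\<close>. Both conditions thus reduce to finding a suitable member
  of \<open>F\<close>: a preimage of \<open>N\<close> or a set of small diameter.\<close>

lemma cauchy_net_pointed_members:
  assumes "F \<noteq> bot" and "F \<le> principal X"
    and nb: "\<And>N. N \<in> nbhds Y y \<Longrightarrow> eventually (\<lambda>x. x \<in> {x \<in> X. f x \<in> N}) F"
    and small: "\<And>\<epsilon>::real. \<epsilon> > 0 \<Longrightarrow>
      \<exists>S\<subseteq>X. eventually (\<lambda>x. x \<in> S) F \<and> pdiam d S < ennreal \<epsilon>"
  shows "cauchy_net_tied_to X Y f d (pointed_members X F) pointed_le fst y"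
  unfolding cauchy_net_tied_to_def
proof (intro conjI ballI allI impI)
  show "directed_set (pointed_members X F) pointed_le"
    using assms(1,2) by (rule directed_set_pointed_members)
  show "fst \<in> pointed_members X F \<rightarrow> X" by (auto simp: pointed_members_def)
  have tail: "\<exists>a\<in>pointed_members X F. \<forall>b\<in>pointed_members X F. pointed_le a b \<longrightarrow> fst b \<in> S"
    if S: "S \<subseteq> X" "eventually (\<lambda>z. z \<in> S) F" for S
  proof -
    obtain x where "(x, S) \<in> pointed_members X F"
      by (rule pointed_membersI[OF assms(1) S])
    then show ?thesis
      by (intro bexI[of _ "(x, S)"]) (auto simp: pointed_members_def)
  qed
  show "\<exists>a\<in>pointed_members X F. \<forall>b\<in>pointed_members X F. pointed_le a b \<longrightarrow> fst b \<in> {x \<in> X. f x \<in> N}"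
    if "N \<in> nbhds Y y" for N
    by (rule tail[OF _ nb[OF that]]) auto
  show "\<exists>a\<in>pointed_members X F. \<forall>b\<in>pointed_members X F. \<forall>c\<in>pointed_members X F.
          pointed_le a b \<and> pointed_le a c \<longrightarrow> d (fst b) (fst c) < \<epsilon>"
    if \<epsilon>: "0 < \<epsilon>" for \<epsilon>
  proof -
    obtain S where S: "S \<subseteq> X" "eventually (\<lambda>x. x \<in> S) F" "pdiam d S < ennreal \<epsilon>"
      using small[OF \<epsilon>] by blast
    have "d u v < \<epsilon>" if "u \<in> S" "v \<in> S" for u v
    proof -
      have "ennreal (d u v) \<le> pdiam d S"
        unfolding pdiam_def using that by (intro SUP_upper2[of u] SUP_upper2[of v]) auto
      \<comment> \<open>The strict bound returns to the reals by contraposing the monotonicity of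
        \<open>ennreal\<close>.\<close>
      then have "\<not> ennreal \<epsilon> \<le> ennreal (d u v)" using S(3) by simp
      then show ?thesis using ennreal_leI[of \<epsilon> "d u v"] by linarith
    qed
    moreover obtain a where "a \<in> pointed_members X F"
      "\<And>b. b \<in> pointed_members X F \<Longrightarrow> pointed_le a b \<Longrightarrow> fst b \<in> S"
      using tail[OF S(1,2)] by blast
    ultimately show ?thesis by (intro bexI[of _ a]) auto
  qed
qed

text \<open>If the net stays in \<open>U\<close> beyond \<open>a\<close>, then pointing
  \<open>snd a \<inter> S\<close> anew gives a later index whose point lies in both \<open>U\<close>
  and \<open>S\<close>.\<close>

lemma limit_pointed_members_imp_cluster_point:
  assumes "F \<noteq> bot"
    and conv: "net_converges T (pointed_members X F) pointed_le fst x"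
  shows "x \<in> cluster_points T F"
  unfolding cluster_points_def in_closure_of
proof (intro CollectI conjI allI impI)
  \<comment> \<open>One copy comes from \<open>cluster_points_def\<close>, the other from
    \<open>in_closure_of\<close>.\<close>
  show "x \<in> topspace T" "x \<in> topspace T" using conv by (simp_all add: net_converges_def)
  fix S U assume S: "eventually (\<lambda>z. z \<in> S) F" and "x \<in> U \<and> openin T U"
  then have "\<exists>a\<in>pointed_members X F. \<forall>b\<in>pointed_members X F. pointed_le a b \<longrightarrow> fst b \<in> U"
    using conv by (simp add: net_converges_def)
  then obtain a where a: "a \<in> pointed_members X F"
    "\<And>b. b \<in> pointed_members X F \<Longrightarrow> pointed_le a b \<Longrightarrow> fst b \<in> U"
    by blast
  then have "snd a \<inter> S \<subseteq> X" "eventually (\<lambda>z. z \<in> snd a \<inter> S) F"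
    using S by (auto simp: pointed_members_def eventually_conj_iff)
  then obtain z where z: "(z, snd a \<inter> S) \<in> pointed_members X F"
    using pointed_membersI[OF assms(1)] by blast
  then have "z \<in> S" by (simp add: pointed_members_def)
  moreover have "z \<in> U" using a(2)[OF z] by simp
  ultimately show "\<exists>z. z \<in> S \<and> z \<in> U" by blast
qed

text \<open>The hypothesis is applied only to nets on \<open>pointed_members X F\<close>, which
  dictates its index type.\<close>

lemma cauchy_nets_converge_imp_complete:
  fixes X :: "'a set"
  assumes "\<And>y (D :: ('a \<times> 'a set) set) le \<Phi>.
      y \<in> topspace Y \<Longrightarrow> cauchy_net_tied_to X Y f d D le \<Phi> y \<Longrightarrow>
      \<exists>x\<in>fibre X f y. net_converges (mapping_topology X Y f d) D le \<Phi> x"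
  shows "complete_metric_on_mapping X Y f d"
  unfolding complete_metric_on_mapping_def
proof (intro ballI allI impI, elim conjE)
  fix y F
  assume y: "y \<in> topspace Y" and F: "F \<noteq> bot" "F \<le> principal X"
    and "\<forall>N\<in>nbhds Y y. eventually (\<lambda>x. x \<in> {x \<in> X. f x \<in> N}) F"
    and "\<forall>\<epsilon>::real. \<epsilon> > 0 \<longrightarrow> (\<exists>S\<subseteq>X. eventually (\<lambda>x. x \<in> S) F \<and> pdiam d S < ennreal \<epsilon>)"
  then have "cauchy_net_tied_to X Y f d (pointed_members X F) pointed_le fst y"
    by (intro cauchy_net_pointed_members) auto
  from assms[OF y this]
  show "fibre X f y \<inter> cluster_points (mapping_topology X Y f d) F \<noteq> {}"
    using limit_pointed_members_imp_cluster_point[OF F(1)] by blast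
qed

(* HOL cannot quantify over the index type of a net inside a formula. The equivalence is stated
   for nets indexed by directed subsets of one fixed type, which is large enough to carry the net
   associated with a filter on X; the second conjunct gives the forward implication for
   directed index sets of an arbitrary type 'i. *)
theorem theorem3:
  fixes X :: "'a set" and Y :: "'b topology" and f :: "'a \<Rightarrow> 'b" and d :: "'a \<Rightarrow> 'a \<Rightarrow> real"
  assumes "f \<in> X \<rightarrow> topspace Y"
    and "metric_on_mapping X Y f d"
  shows "(complete_metric_on_mapping X Y f d \<longleftrightarrow>
            (\<forall>y \<in> topspace Y. \<forall>(D :: ('a \<times> 'a set) set) le \<Phi>.
               cauchy_net_tied_to X Y f d D le \<Phi> y \<longrightarrow>
               (\<exists>x \<in> fibre X f y. net_converges (mapping_topology X Y f d) D le \<Phi> x)))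
       \<and> (complete_metric_on_mapping X Y f d \<longrightarrow>
            (\<forall>y \<in> topspace Y. \<forall>(D :: 'i set) le \<Phi>.
               cauchy_net_tied_to X Y f d D le \<Phi> y \<longrightarrow>
               (\<exists>x \<in> fibre X f y. net_converges (mapping_topology X Y f d) D le \<Phi> x)))"
proof -
  have "Pseudometric_space X d" using assms(2) by (simp add: metric_on_mapping_def)
  \<comment> \<open>The index type stays schematic here, so \<open>forward\<close> serves both
    conjuncts.\<close>
  note forward = complete_imp_cauchy_net_converges[OF this assms(1)]
  show ?thesis
    by (intro conjI iffI ballI allI impI cauchy_nets_converge_imp_complete)
      (blast intro: forward)+
qed

end
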